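(* Let $Y$ be a finite dimensional Euclidean space, $K\subseteq Y$ a closed convex cone and $A:\mathbb{R}^m\to Y$ an injective linear map. The set $A^*K^*$ is not closed if and only if there are $(a_1,\dots,a_{k+1})\in\mathrm{FR}_{k+1}(K^* )$ with $k\ge1$ and $(y_1,\dots,y_{\ell+1})\in\mathrm{FR}_{\ell+1}(K)$ with $\ell\ge1$ such that $$a_i\in\mathcal{R}(A)\ (i=1,\dots,k+1),\qquad y_j\in\mathcal{N}(A^* )\ (j=1,\dots,\ell),$$ and $$\langle a_i,y_{\ell+1}\rangle=\begin{cases}0&\text{if } i\le k,\\-1&\text{if } i=k+1.\end{cases}$$
   Context: $K^*=\{y\in Y:\langle y,x\rangle\ge0\ \forall x\in K\}$; $A^*$ is the adjoint of $A$; $\mathcal{R}(\cdot)$ and $\mathcal{N}(\cdot)$ denote range space and null space; $A^*K^*=\{A^*y: y\in K^*\}\subseteq\mathbb{R}^m$. For a closed convex cone $C$ and $k\ge1$, $$\mathrm{FR}_k(C)=\{(y_1,\dots,y_k): y_1\in C^*,\ y_i\in(C\cap y_1^\perp\cap\dots\cap y_{i-1}^\perp)^*,\ i=2,\dots,k\}.$$ *)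

theory Defs
  imports "HOL-Analysis.Analysis"
begin

definition dual_cone :: "'a::real_inner set \<Rightarrow> 'a set"
  where "dual_cone K = {y. \<forall>x\<in>K. 0 \<le> y \<bullet> x}"

(* A k-tuple (y_1, ..., y_k) is a list ys of length k with y_i = ys ! (i - 1).
   For i = 0 the intersection below is UNIV, so the condition reads
   "ys ! 0 is in dual_cone C". *)
definition FR :: "nat \<Rightarrow> 'a::real_inner set \<Rightarrow> 'a list set"
  where "FR k C = {ys. length ys = k \<and>
    (\<forall>i<k. ys ! i \<in> dual_cone (C \<inter> (\<Inter>j<i. orthogonal_comp {ys ! j})))}"

end

theory Submission
  imports Defs
begin

text \<open>The set \<open>adjoint A ` dual_cone K\<close> fails to be closed exactly when some \<open>c\<close> lies in its
  closure but not in the set itself. The two tuples certify these two facts about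
  \<open>c = adjoint A (ys ! l)\<close>: \<open>ys\<close> shows that \<open>c\<close> is in the closure, and \<open>as\<close> that it is not
  attained.

  A point \<open>c\<close> is in the closure if and only if \<open>c\<close> is nonnegative on \<open>{x. A x \<in> K}\<close>
  (lemma \<open>mem_closure_adjoint_image_iff\<close>). If \<open>A x \<in> K\<close>, then the entries of \<open>ys\<close>
  before the last, being in the kernel of \<open>adjoint A\<close>, vanish on \<open>A x\<close>; so \<open>A x\<close> lies in the
  face on which the last entry is nonnegative. Similarly, if \<open>c = adjoint A y\<close> with
  \<open>y \<in> dual_cone K\<close>, then every \<open>as ! i \<in> range A\<close> takes the same value on \<open>y\<close> as on
  \<open>ys ! l\<close>; so \<open>y\<close> lies in the face on which \<open>as ! k\<close> is nonnegative, contradicting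
  the value \<open>- 1\<close>. This is the sufficiency of the certificates.

  For the necessity both tuples are produced by facial reduction (lemma
  \<open>facial_reduction\<close>): as long as some functional in a prescribed set \<open>L\<close> is nonnegative but
  not identically zero on the current face, append it to the tuple. The dimension drops each
  time, so the process ends with a face on which every functional of \<open>L\<close> that is nonnegative
  vanishes. On such a face the usual obstructions to duality have disappeared. With \<open>L\<close> the kernel of
  \<open>adjoint A\<close>, every \<open>c\<close> in the closure is \<open>adjoint A y0\<close> for some \<open>y0\<close> in the dual of the
  reduced face of \<open>K\<close> (lemma \<open>adjoint_image_dual_cone_eqI\<close>), and \<open>y0\<close> is the last entry of
  \<open>ys\<close>. With \<open>L\<close> the elements of \<open>range A\<close> orthogonal to \<open>y0\<close>, the reduced face of
  \<open>dual_cone K\<close> can be strictly separated from the fibre \<open>{y. adjoint A y = c}\<close> that it misses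
  (lemma \<open>separate_reduced_face_from_fibre\<close>), and the separating functional is the last entry of
  \<open>as\<close>.

  Both duality statements come from one principle: a convex cone whose dual cone vanishes on it
  is a linear subspace (lemma \<open>uminus_mem_if_dual_cone_annihilates\<close>).\<close>

section \<open>Convex cones and their duals\<close>

lemma dual_coneI: "(\<And>x. x \<in> C \<Longrightarrow> 0 \<le> y \<bullet> x) \<Longrightarrow> y \<in> dual_cone C"
  by (simp add: dual_cone_def)

lemma dual_coneD: "y \<in> dual_cone C \<Longrightarrow> x \<in> C \<Longrightarrow> 0 \<le> y \<bullet> x"
  by (simp add: dual_cone_def)

lemma convex_cone_dual_cone: "convex_cone (dual_cone C)"
  by (auto simp: convex_cone_iff dual_cone_def inner_add_left)

lemma scaleR_dual_cone: "a \<in> dual_cone C \<Longrightarrow> 0 \<le> t \<Longrightarrow> t *\<^sub>R a \<in> dual_cone C"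
  using convex_cone_dual_cone convex_cone_scaleR by blast

lemma separate_from_convex_cone:
  fixes C :: "'a::euclidean_space set"
  assumes C: "convex_cone C" and z: "z \<notin> closure C"
  obtains a where "a \<in> dual_cone C" "a \<bullet> z < 0"
proof -
  have "convex (closure C)"
    using C by (simp add: convex_cone_def convex_closure)
  then obtain a b where ab: "a \<bullet> z < b" "\<And>x. x \<in> closure C \<Longrightarrow> b < a \<bullet> x"
    using separating_hyperplane_closed_point[of "closure C" z] z by auto
  have "0 \<in> closure C"
    using convex_cone_contains_0[OF C] closure_subset by blast
  with ab(2)[of 0] have b: "b < 0" by simp
  have "0 \<le> a \<bullet> x" if "x \<in> C" for x
  proof (rule ccontr)
    assume neg: "\<not> 0 \<le> a \<bullet> x"
    \<comment> \<open>the multiple of \<open>x\<close> on which \<open>a\<close> attains the value \<open>b\<close>\<close>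
    define t where "t = b / (a \<bullet> x)"
    have "0 \<le> t" using b neg by (simp add: t_def divide_nonpos_neg)
    then have "t *\<^sub>R x \<in> closure C"
      using C that closure_subset convex_cone_scaleR by blast
    from ab(2)[OF this] neg show False by (simp add: t_def)
  qed
  then show ?thesis using ab(1) b by (intro that[of a] dual_coneI) auto
qed

lemma bidual_subset_closure:
  fixes C :: "'a::euclidean_space set"
  assumes "convex_cone C"
  shows "dual_cone (dual_cone C) \<subseteq> closure C"
proof
  fix z assume z: "z \<in> dual_cone (dual_cone C)"
  show "z \<in> closure C"
  proof (rule ccontr)
    assume "z \<notin> closure C"
    then obtain a where "a \<in> dual_cone C" "a \<bullet> z < 0"
      using separate_from_convex_cone assms by blast
    then show False using dual_coneD[OF z, of a] by (simp add: inner_commute)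
  qed
qed

text \<open>By the bipolar theorem such a cone has a closure that is symmetric, hence a linear
  subspace. A convex set contains the relative interior of its closure, and a subspace is its
  own relative interior; so the cone equals its closure although it is not assumed closed.\<close>

lemma uminus_mem_if_dual_cone_annihilates:
  fixes P :: "'a::euclidean_space set"
  assumes P: "convex_cone P"
    and ann: "\<And>a p. a \<in> dual_cone P \<Longrightarrow> p \<in> P \<Longrightarrow> a \<bullet> p = 0"
    and p: "p \<in> P"
  shows "- p \<in> P"
proof -
  have "dual_cone P \<subseteq> {a. \<forall>p\<in>closure P. a \<bullet> p = 0}"
  proof clarify
    fix a q assume "a \<in> dual_cone P" "q \<in> closure P"
    moreover have "closed {q. a \<bullet> q = 0}" by (rule closed_hyperplane)
    ultimately show "a \<bullet> q = 0"
      using ann closure_minimal[of P "{q. a \<bullet> q = 0}"] by auto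
  qed
  then have uminus: "- q \<in> closure P" if "q \<in> closure P" for q
    using that bidual_subset_closure[OF P]
    by (fastforce simp: dual_cone_def inner_commute)
  have P': "convex_cone (closure P)"
    using P by (simp add: convex_cone_def convex_closure conic_closure)
  have "subspace (closure P)"
    unfolding subspace_def
  proof (intro conjI ballI allI)
    show "0 \<in> closure P" using convex_cone_contains_0[OF P'] .
  next
    fix x y assume "x \<in> closure P" "y \<in> closure P"
    then show "x + y \<in> closure P" using convex_cone_add[OF P'] by blast
  next
    fix r :: real and x assume x: "x \<in> closure P"
    show "r *\<^sub>R x \<in> closure P"
    proof (cases "0 \<le> r")
      case True then show ?thesis using convex_cone_scaleR[OF P'] x by blast
    next
      case False
      then have "(- r) *\<^sub>R (- x) \<in> closure P"
        using convex_cone_scaleR[OF P' _ uminus[OF x], of "- r"] by simp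
      then show ?thesis by simp
    qed
  qed
  then have "closure P = rel_interior (closure P)"
    using rel_interior_affine subspace_imp_affine by metis
  also have "\<dots> = rel_interior P"
    using P by (intro convex_rel_interior_closure) (simp add: convex_cone_def)
  also have "\<dots> \<subseteq> P" by (rule rel_interior_subset)
  finally show ?thesis using uminus p closure_subset by blast
qed

text \<open>The sum \<open>F + M\<close> is a subspace by the previous lemma, so it contains \<open>- m\<close>. Below \<open>M\<close>
  is built from a linear constraint, and the resulting point \<open>- (m + n)\<close> of \<open>F\<close> satisfies the
  reversed constraint strictly, because \<open>m\<close> satisfies the constraint strictly and \<open>n\<close> weakly.\<close>

lemma add_mem_uminus_cone:
  fixes F M :: "'a::euclidean_space set"
  assumes F: "convex_cone F" and M: "convex_cone M"
    and ann: "\<And>a. a \<in> dual_cone F \<Longrightarrow> a \<in> dual_cone M \<Longrightarrow>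
      (\<forall>f\<in>F. a \<bullet> f = 0) \<and> (\<forall>m\<in>M. a \<bullet> m = 0)"
    and m: "m \<in> M"
  obtains n where "n \<in> M" "- (m + n) \<in> F"
proof -
  define P where "P = (\<Union>f\<in>F. \<Union>m\<in>M. {f + m})"
  have P: "convex_cone P" unfolding P_def by (rule convex_cone_sums[OF F M])
  have F0: "0 \<in> F" and M0: "0 \<in> M" using F M convex_cone_contains_0 by auto
  have sub: "F \<subseteq> P" "M \<subseteq> P"
    using F0 M0 by (force simp: P_def)+
  have "- m \<in> P"
  proof (rule uminus_mem_if_dual_cone_annihilates[OF P])
    fix a p assume a: "a \<in> dual_cone P" and p: "p \<in> P"
    have "a \<in> dual_cone F" "a \<in> dual_cone M" using a sub by (auto simp: dual_cone_def)
    from ann[OF this] p show "a \<bullet> p = 0" by (auto simp: P_def inner_add_right)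
  qed (use m sub in blast)
  then obtain f n where "f \<in> F" "n \<in> M" "- m = f + n" by (auto simp: P_def)
  moreover from this have "- (m + n) = f" by (simp add: minus_add algebra_simps)
  ultimately show ?thesis using that[of n] by simp
qed

section \<open>Facial reduction\<close>

definition face :: "'a::real_inner set \<Rightarrow> 'a list \<Rightarrow> 'a set"
  where "face C ys = {x \<in> C. \<forall>y\<in>set ys. y \<bullet> x = 0}"

lemma face_subset: "face C ys \<subseteq> C"
  by (auto simp: face_def)

lemma face_append: "face C (ys @ [a]) = {x \<in> face C ys. a \<bullet> x = 0}"
  by (auto simp: face_def)

lemma convex_cone_face: "convex_cone C \<Longrightarrow> convex_cone (face C ys)"
  by (auto simp: face_def convex_cone_iff inner_add_right)

lemma FR_iff_face:
  "ys \<in> FR k C \<longleftrightarrow> length ys = k \<and> (\<forall>i<k. ys ! i \<in> dual_cone (face C (take i ys)))"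
proof -
  have "C \<inter> (\<Inter>j<i. orthogonal_comp {ys ! j}) = face C (take i ys)" if "i < length ys" for i
  proof -
    have "set (take i ys) = (!) ys ` {..<i}"
      using nth_image[of i ys] that by (simp add: lessThan_atLeast0)
    then show ?thesis by (auto simp: face_def orthogonal_comp_def orthogonal_def)
  qed
  then have "ys ! i \<in> dual_cone (C \<inter> (\<Inter>j<i. orthogonal_comp {ys ! j}))
      \<longleftrightarrow> ys ! i \<in> dual_cone (face C (take i ys))" if "i < length ys" for i
    using that by simp
  then show ?thesis unfolding FR_def by blast
qed

lemma FR_append:
  assumes "ys \<in> FR k C" "a \<in> dual_cone (face C ys)"
  shows "ys @ [a] \<in> FR (k + 1) C"
  using assms by (auto simp: FR_iff_face nth_append less_Suc_eq)

text \<open>This is how a facial reduction sequence is used as a certificate: the orthogonality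
  conditions place \<open>x\<close> in the face whose dual cone contains the last entry.\<close>

lemma FR_inner_nonneg:
  assumes "ys \<in> FR (k + 1) C" "x \<in> C" "\<And>i. i < k \<Longrightarrow> ys ! i \<bullet> x = 0"
  shows "0 \<le> ys ! k \<bullet> x"
proof (rule dual_coneD)
  show "ys ! k \<in> dual_cone (face C (take k ys))" using assms(1) by (simp add: FR_iff_face)
  show "x \<in> face C (take k ys)"
    using assms by (auto simp: face_def in_set_conv_nth FR_iff_face)
qed

text \<open>A functional \<open>a\<close> that is nonnegative but not identically zero on the current face cuts out
  a face contained in the hyperplane orthogonal to \<open>a\<close>. Its span is therefore strictly smaller,
  which gives an induction on the dimension of the face.\<close>

lemma facial_reduction_extend:
  fixes C :: "'a::euclidean_space set"
  assumes "ys \<in> FR (length ys) C" "set ys \<subseteq> L"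
  shows "\<exists>zs. length ys \<le> length zs \<and> zs \<in> FR (length zs) C \<and> set zs \<subseteq> L \<and>
    (\<forall>a\<in>dual_cone (face C zs) \<inter> L. \<forall>x\<in>face C zs. a \<bullet> x = 0)"
  using assms
proof (induction "dim (face C ys)" arbitrary: ys rule: less_induct)
  case less
  show ?case
  proof (cases "\<forall>a\<in>dual_cone (face C ys) \<inter> L. \<forall>x\<in>face C ys. a \<bullet> x = 0")
    case True
    then show ?thesis using less.prems by blast
  next
    case False
    then obtain a x where a: "a \<in> dual_cone (face C ys)" "a \<in> L"
      and x: "x \<in> face C ys" "a \<bullet> x \<noteq> 0" by blast
    let ?F = "face C ys" and ?F' = "face C (ys @ [a])"
    have "?F' \<subseteq> {z. a \<bullet> z = 0}" by (auto simp: face_append)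
    then have "span ?F' \<subseteq> {z. a \<bullet> z = 0}"
      by (rule span_minimal) (rule subspace_hyperplane)
    then have "x \<notin> span ?F'" using x by blast
    moreover have "span ?F' \<subseteq> span ?F"
      by (rule span_mono) (auto simp: face_append)
    ultimately have "span ?F' \<subset> span ?F"
      using x(1) span_base by blast
    then have "dim ?F' < dim ?F" by (rule dim_psubset)
    moreover have "ys @ [a] \<in> FR (length (ys @ [a])) C"
      using FR_append[OF less.prems(1) a(1)] by simp
    ultimately obtain zs where "length (ys @ [a]) \<le> length zs \<and> zs \<in> FR (length zs) C \<and> set zs \<subseteq> L
      \<and> (\<forall>a\<in>dual_cone (face C zs) \<inter> L. \<forall>x\<in>face C zs. a \<bullet> x = 0)"
      using less.hyps[of "ys @ [a]"] less.prems(2) a(2) by auto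
    then show ?thesis by (intro exI[of _ zs]) auto
  qed
qed

lemma facial_reduction:
  fixes C :: "'a::euclidean_space set"
  assumes "0 \<in> L"
  obtains zs where "1 \<le> length zs" "zs \<in> FR (length zs) C" "set zs \<subseteq> L"
    "\<forall>a\<in>dual_cone (face C zs) \<inter> L. \<forall>x\<in>face C zs. a \<bullet> x = 0"
proof -
  \<comment> \<open>starting from the tuple \<open>(0)\<close> makes the length positive\<close>
  have "[0] \<in> FR (length [0 :: 'a]) C" by (simp add: FR_iff_face dual_cone_def)
  from facial_reduction_extend[OF this, of L] assms show ?thesis
    using that by auto
qed

section \<open>Duality on fully reduced faces\<close>

lemma range_eq_orthogonal_ker_adjoint:
  fixes A :: "'b::euclidean_space \<Rightarrow> 'a::euclidean_space"
  assumes A: "linear A" and a: "\<And>y. adjoint A y = 0 \<Longrightarrow> a \<bullet> y = 0"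
  shows "a \<in> range A"
proof -
  have "adjoint A -` {0} = orthogonal_comp (range A)"
    using ker_orthogonal_comp_adjoint[OF adjoint_linear[OF A]] adjoint_adjoint[OF A] by simp
  then have "a \<in> orthogonal_comp (orthogonal_comp (range A))"
    using a by (auto simp: orthogonal_comp_def orthogonal_def inner_commute)
  then show ?thesis
    using orthogonal_comp_self linear_subspace_image[OF A subspace_UNIV] by blast
qed

text \<open>A Farkas lemma in which reducedness of \<open>F\<close> replaces a closedness assumption. If \<open>c\<close> is
  not attained, no element of \<open>dual_cone F\<close> is mapped by \<open>adjoint A\<close> to a positive multiple of
  \<open>c\<close>. Hence the functionals that are nonnegative both on \<open>F\<close> and on the image \<open>M\<close> of the
  half-space \<open>{x. 0 \<le> c \<bullet> x}\<close> lie in the kernel of \<open>adjoint A\<close>; these vanish on \<open>M\<close>, and on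
  \<open>F\<close> by reducedness. So \<open>F + M\<close> is a subspace, and writing \<open>- A c\<close> as an element of it
  yields some \<open>A x \<in> F\<close> with \<open>c \<bullet> x < 0\<close>.\<close>

lemma adjoint_image_dual_cone_eqI:
  fixes A :: "'b::euclidean_space \<Rightarrow> 'a::euclidean_space"
  assumes A: "linear A" and F: "convex_cone F"
    and reduced: "\<And>a f. a \<in> dual_cone F \<Longrightarrow> adjoint A a = 0 \<Longrightarrow> f \<in> F \<Longrightarrow> a \<bullet> f = 0"
    and c: "\<And>x. A x \<in> F \<Longrightarrow> 0 \<le> c \<bullet> x"
  obtains y where "y \<in> dual_cone F" "adjoint A y = c"
proof (rule ccontr)
  note goal = that
  assume "\<not> thesis"
  have none: "adjoint A y \<noteq> c" if "y \<in> dual_cone F" for y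
    using \<open>\<not> thesis\<close> goal that by blast
  have c0: "c \<noteq> 0"
    using none[of 0] linear_0[OF adjoint_linear[OF A]] by (auto simp: dual_cone_def)
  define M where "M = A ` {x. 0 \<le> c \<bullet> x}"
  have M: "convex_cone M"
    unfolding M_def using convex_cone_linear_image convex_cone_halfspace_ge A by blast
  have ker: "adjoint A a = 0" if aF: "a \<in> dual_cone F" and aM: "a \<in> dual_cone M" for a
  proof -
    have nonneg: "0 \<le> adjoint A a \<bullet> x" if "0 \<le> c \<bullet> x" for x
      using dual_coneD[OF aM, of "A x"] that adjoint_works[OF A, of x a]
      by (auto simp: M_def inner_commute)
    define s where "s = (adjoint A a \<bullet> c) / (c \<bullet> c)"
    define v where "v = adjoint A a - s *\<^sub>R c"
    have s: "0 \<le> s" using nonneg[of c] by (simp add: s_def)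
    have vc: "c \<bullet> v = 0"
      using c0 by (simp add: v_def s_def inner_diff_right inner_commute)
    \<comment> \<open>both \<open>v\<close> and \<open>- v\<close> lie in the half-space, so the part of \<open>adjoint A a\<close> orthogonal
      to \<open>c\<close> vanishes\<close>
    have "adjoint A a \<bullet> v = 0"
      using nonneg[of v] nonneg[of "- v"] vc by simp
    then have "v \<bullet> v = 0" using vc by (simp add: inner_diff_left v_def[THEN arg_cong[of _ _ "\<lambda>u. u \<bullet> v"]])
    then have eq: "adjoint A a = s *\<^sub>R c" by (simp add: v_def)
    have "s = 0"
    proof (rule ccontr)
      assume "s \<noteq> 0"
      then have "adjoint A ((1 / s) *\<^sub>R a) = c"
        using eq by (simp add: linear_cmul[OF adjoint_linear[OF A]])
      then show False using none scaleR_dual_cone[OF aF, of "1 / s"] s by simp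
    qed
    then show ?thesis using eq by simp
  qed
  have "(\<forall>f\<in>F. a \<bullet> f = 0) \<and> (\<forall>m\<in>M. a \<bullet> m = 0)"
    if "a \<in> dual_cone F" "a \<in> dual_cone M" for a
    using ker[OF that] reduced[OF that(1)] adjoint_works[OF A, of _ a]
    by (auto simp: M_def inner_commute)
  moreover have "A c \<in> M" by (auto simp: M_def)
  ultimately obtain n where "n \<in> M" "- (A c + n) \<in> F"
    using add_mem_uminus_cone[OF F M] by blast
  then obtain x where x: "0 \<le> c \<bullet> x" "- (A c + A x) \<in> F" by (auto simp: M_def)
  \<comment> \<open>the point \<open>- (c + x)\<close> is mapped into \<open>F\<close>, but \<open>c\<close> is negative on it\<close>
  have "A (- (c + x)) \<in> F" using x(2) by (simp only: linear_neg[OF A] linear_add[OF A])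
  from c[OF this] x(1) have "c \<bullet> c \<le> 0" by (simp add: inner_diff_right)
  then show False using c0 by (simp add: inner_gt_zero_iff not_less[symmetric])
qed

text \<open>Let \<open>M\<close> consist of the points that \<open>adjoint A\<close> sends to \<open>- t *\<^sub>R adjoint A y0\<close> with
  \<open>0 \<le> t\<close>. A functional nonnegative on \<open>M\<close> vanishes on the kernel of \<open>adjoint A\<close>, hence lies in
  \<open>range A\<close>, and is nonpositive at \<open>y0\<close>. If none that is also in \<open>dual_cone F\<close> is negative at
  \<open>y0\<close>, where it could be scaled to \<open>- 1\<close>, then by reducedness all of them vanish on \<open>F\<close> and
  on \<open>M\<close>. So \<open>F + M\<close> is a subspace, and writing \<open>y0\<close> as an element of it and rescaling
  gives a point of \<open>F\<close> in the fibre of \<open>y0\<close>.\<close>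

lemma separate_reduced_face_from_fibre:
  fixes A :: "'b::euclidean_space \<Rightarrow> 'a::euclidean_space"
  assumes A: "linear A" and F: "convex_cone F"
    and reduced: "\<And>a f. a \<in> dual_cone F \<Longrightarrow> a \<in> range A \<Longrightarrow> a \<bullet> y0 = 0 \<Longrightarrow> f \<in> F \<Longrightarrow> a \<bullet> f = 0"
    and disjoint: "\<And>y. y \<in> F \<Longrightarrow> adjoint A y \<noteq> adjoint A y0"
  obtains a where "a \<in> dual_cone F" "a \<in> range A" "a \<bullet> y0 = - 1"
proof (rule ccontr)
  note goal = that
  assume "\<not> thesis"
  have none: "a \<bullet> y0 \<noteq> - 1" if "a \<in> dual_cone F" "a \<in> range A" for a
    using \<open>\<not> thesis\<close> goal that by blast
  note lin = adjoint_linear[OF A]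
  define M where "M = {w. \<exists>t\<ge>0. adjoint A w = - t *\<^sub>R adjoint A y0}"
  have M: "convex_cone M"
    unfolding convex_cone_iff
  proof (intro conjI ballI allI impI)
    show "0 \<in> M" by (auto simp: M_def linear_0[OF lin])
  next
    fix x y assume "x \<in> M" "y \<in> M"
    then obtain s t where "0 \<le> s" "0 \<le> t" "adjoint A x = - s *\<^sub>R adjoint A y0"
      "adjoint A y = - t *\<^sub>R adjoint A y0" by (auto simp: M_def)
    then have "0 \<le> s + t" "adjoint A (x + y) = - (s + t) *\<^sub>R adjoint A y0"
      by (auto simp: linear_add[OF lin] algebra_simps)
    then show "x + y \<in> M" unfolding M_def by blast
  next
    fix x and r :: real assume "x \<in> M" "0 \<le> r"
    then obtain t where "0 \<le> t" "adjoint A x = - t *\<^sub>R adjoint A y0" by (auto simp: M_def)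
    then have "0 \<le> r * t" "adjoint A (r *\<^sub>R x) = - (r * t) *\<^sub>R adjoint A y0"
      using \<open>0 \<le> r\<close> by (auto simp: linear_cmul[OF lin])
    then show "r *\<^sub>R x \<in> M" unfolding M_def by blast
  qed
  have y0M: "- y0 \<in> M" by (auto simp: M_def linear_neg[OF lin] intro!: exI[of _ 1])
  have "(\<forall>f\<in>F. a \<bullet> f = 0) \<and> (\<forall>m\<in>M. a \<bullet> m = 0)"
    if aF: "a \<in> dual_cone F" and aM: "a \<in> dual_cone M" for a
  proof -
    have ker: "a \<bullet> y = 0" if "adjoint A y = 0" for y
    proof -
      have "y \<in> M" "- y \<in> M" using that by (auto simp: M_def linear_neg[OF lin] intro!: exI[of _ 0])
      from this[THEN dual_coneD[OF aM]] show ?thesis by simp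
    qed
    have range: "a \<in> range A" by (rule range_eq_orthogonal_ker_adjoint[OF A ker])
    have y0: "a \<bullet> y0 = 0"
    proof (rule ccontr)
      assume "a \<bullet> y0 \<noteq> 0"
      then have neg: "a \<bullet> y0 < 0" using dual_coneD[OF aM y0M] by simp
      let ?b = "(- 1 / (a \<bullet> y0)) *\<^sub>R a"
      have "?b \<in> dual_cone F" using neg by (intro scaleR_dual_cone aF) (simp add: divide_nonpos_neg)
      moreover have "?b \<in> range A"
        using linear_subspace_image[OF A subspace_UNIV] range by (rule subspace_scale)
      ultimately show False using none[of ?b] neg by simp
    qed
    have "a \<bullet> m = 0" if m: "m \<in> M" for m
    proof -
      obtain t where "adjoint A m = - t *\<^sub>R adjoint A y0"
        using m unfolding M_def by blast
      then have "adjoint A (m + t *\<^sub>R y0) = 0" by (simp add: linear_add[OF lin] linear_cmul[OF lin])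
      from ker[OF this] y0 show ?thesis by (simp add: inner_add_right)
    qed
    then show ?thesis using reduced[OF aF range y0] by blast
  qed
  from add_mem_uminus_cone[OF F M this y0M] obtain n
    where n: "n \<in> M" "- (- y0 + n) \<in> F" by blast
  then obtain t where t: "0 \<le> t" "adjoint A n = - t *\<^sub>R adjoint A y0" by (auto simp: M_def)
  \<comment> \<open>\<open>adjoint A\<close> maps \<open>y0 - n\<close> to \<open>(1 + t) *\<^sub>R adjoint A y0\<close>, a positive multiple as \<open>0 \<le> t\<close>\<close>
  let ?y = "(1 / (1 + t)) *\<^sub>R (- (- y0 + n))"
  have "?y \<in> F" using convex_cone_scaleR[OF F _ n(2)] t(1) by simp
  moreover have "adjoint A (- (- y0 + n)) = (1 + t) *\<^sub>R adjoint A y0"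
    by (simp only: linear_neg[OF lin] linear_add[OF lin] t(2)) (simp add: algebra_simps)
  then have "adjoint A ?y = adjoint A y0"
    using t(1) by (simp only: linear_cmul[OF lin]) simp
  ultimately show False using disjoint by blast
qed

section \<open>Nonclosedness certificates\<close>

text \<open>The bipolar theorem for the cone \<open>adjoint A ` dual_cone K\<close>: its dual cone is
  \<open>{x. A x \<in> K}\<close>, because \<open>K\<close>, being closed, equals its own bidual.\<close>

lemma mem_closure_adjoint_image_iff:
  fixes A :: "'b::euclidean_space \<Rightarrow> 'a::euclidean_space"
  assumes A: "linear A" and K: "convex_cone K" "closed K"
  shows "c \<in> closure (adjoint A ` dual_cone K) \<longleftrightarrow> (\<forall>x. A x \<in> K \<longrightarrow> 0 \<le> c \<bullet> x)"
proof (intro iffI allI impI)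
  fix x assume c: "c \<in> closure (adjoint A ` dual_cone K)" and x: "A x \<in> K"
  have "adjoint A ` dual_cone K \<subseteq> {z. 0 \<le> x \<bullet> z}"
    using x by (auto simp: adjoint_works[OF A] dual_cone_def inner_commute)
  then have "closure (adjoint A ` dual_cone K) \<subseteq> {z. 0 \<le> x \<bullet> z}"
    using closed_halfspace_ge[of 0 x] by (intro closure_minimal) auto
  then show "0 \<le> c \<bullet> x" using c by (auto simp: inner_commute)
next
  assume c: "\<forall>x. A x \<in> K \<longrightarrow> 0 \<le> c \<bullet> x"
  show "c \<in> closure (adjoint A ` dual_cone K)"
  proof (rule ccontr)
    assume "c \<notin> closure (adjoint A ` dual_cone K)"
    then obtain x where x: "x \<in> dual_cone (adjoint A ` dual_cone K)" "x \<bullet> c < 0"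
      using separate_from_convex_cone
        convex_cone_linear_image[OF conjI[OF convex_cone_dual_cone adjoint_linear[OF A]]] by blast
    have "A x \<in> dual_cone (dual_cone K)"
      using x(1) by (auto simp: dual_cone_def adjoint_works[OF A])
    then have "A x \<in> K" using bidual_subset_closure[OF K(1)] K(2) by auto
    then show False using c x(2) by (auto simp: inner_commute)
  qed
qed

theorem theorem6:
  fixes K :: "'a::euclidean_space set"
    and A :: "real ^ 'm \<Rightarrow> 'a"
  assumes "convex_cone K" and "closed K"
    and "linear A" and "inj A"
  shows "\<not> closed (adjoint A ` dual_cone K) \<longleftrightarrow>
    (\<exists>k l as ys. 1 \<le> k \<and> 1 \<le> l
      \<and> as \<in> FR (k + 1) (dual_cone K)
      \<and> ys \<in> FR (l + 1) K
      \<and> (\<forall>i < k + 1. as ! i \<in> range A)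
      \<and> (\<forall>j < l. adjoint A (ys ! j) = 0)
      \<and> (\<forall>i < k + 1. as ! i \<bullet> ys ! l = (if i < k then 0 else - 1)))"
    (is "_ \<longleftrightarrow> ?cert")
proof
  note A = \<open>linear A\<close>
  assume "\<not> closed (adjoint A ` dual_cone K)"
  then obtain c where c: "c \<in> closure (adjoint A ` dual_cone K)" "c \<notin> adjoint A ` dual_cone K"
    using closure_subset by (metis subset_antisym subsetI closure_eq)
  have nonneg: "0 \<le> c \<bullet> x" if "A x \<in> K" for x
    using c(1) that mem_closure_adjoint_image_iff assms by blast
  obtain ys where ys: "1 \<le> length ys" "ys \<in> FR (length ys) K" "set ys \<subseteq> {y. adjoint A y = 0}"
    and ys_red: "\<forall>a\<in>dual_cone (face K ys) \<inter> {y. adjoint A y = 0}. \<forall>x\<in>face K ys. a \<bullet> x = 0"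
    using facial_reduction[of "{y. adjoint A y = 0}" K] linear_0[OF adjoint_linear[OF A]]
    by blast
  obtain y0 where y0: "y0 \<in> dual_cone (face K ys)" "adjoint A y0 = c"
  proof (rule adjoint_image_dual_cone_eqI[OF A convex_cone_face[OF assms(1)]])
    show "a \<bullet> x = 0" if "a \<in> dual_cone (face K ys)" "adjoint A a = 0" "x \<in> face K ys" for a x
      using ys_red that by blast
    show "0 \<le> c \<bullet> x" if "A x \<in> face K ys" for x
      using nonneg that face_subset[of K ys] by blast
  qed
  let ?L = "{a \<in> range A. a \<bullet> y0 = 0}"
  have "0 \<in> ?L" using linear_0[OF A] by (auto intro: rev_image_eqI[of 0])
  then obtain as where as: "1 \<le> length as" "as \<in> FR (length as) (dual_cone K)" "set as \<subseteq> ?L"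
    and as_red: "\<forall>a\<in>dual_cone (face (dual_cone K) as) \<inter> ?L. \<forall>x\<in>face (dual_cone K) as. a \<bullet> x = 0"
    by (rule facial_reduction)
  obtain a where a: "a \<in> dual_cone (face (dual_cone K) as)" "a \<in> range A" "a \<bullet> y0 = - 1"
  proof (rule separate_reduced_face_from_fibre[OF A convex_cone_face[OF convex_cone_dual_cone]])
    show "a \<bullet> f = 0" if "a \<in> dual_cone (face (dual_cone K) as)" "a \<in> range A" "a \<bullet> y0 = 0"
      "f \<in> face (dual_cone K) as" for a f
      using as_red that by blast
    show "adjoint A y \<noteq> adjoint A y0" if "y \<in> face (dual_cone K) as" for y
    proof
      assume "adjoint A y = adjoint A y0"
      moreover have "y \<in> dual_cone K" using that face_subset[of "dual_cone K" as] by (rule rev_subsetD)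
      ultimately show False using c(2) y0(2) by (metis imageI)
    qed
  qed
  have as_nth: "as ! i \<in> ?L" if "i < length as" for i
    using that as(3) nth_mem by blast
  have ys_nth: "adjoint A (ys ! j) = 0" if "j < length ys" for j
    using that ys(3) nth_mem by blast
  show ?cert
  proof (intro exI conjI)
    show "as @ [a] \<in> FR (length as + 1) (dual_cone K)" using FR_append as(2) a(1) by blast
    show "ys @ [y0] \<in> FR (length ys + 1) K" using FR_append ys(2) y0(1) by blast
  qed (use as ys a as_nth ys_nth in \<open>simp_all add: nth_append less_Suc_eq\<close>)
next
  note A = \<open>linear A\<close>
  assume ?cert
  then obtain k l as ys where as: "as \<in> FR (k + 1) (dual_cone K)" and ys: "ys \<in> FR (l + 1) K"
    and range: "\<And>i. i < k + 1 \<Longrightarrow> as ! i \<in> range A"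
    and ker: "\<And>j. j < l \<Longrightarrow> adjoint A (ys ! j) = 0"
    and vals: "\<And>i. i < k + 1 \<Longrightarrow> as ! i \<bullet> ys ! l = (if i < k then 0 else - 1)" by blast
  let ?c = "adjoint A (ys ! l)"
  have "0 \<le> ?c \<bullet> x" if x: "A x \<in> K" for x
  proof -
    have "ys ! j \<bullet> A x = 0" if "j < l" for j
      using ker[OF that] adjoint_works[OF A, of x "ys ! j"] by (simp add: inner_commute)
    then have "0 \<le> ys ! l \<bullet> A x" by (rule FR_inner_nonneg[OF ys x])
    then show ?thesis using adjoint_works[OF A, of x "ys ! l"] by (simp add: inner_commute)
  qed
  then have closure: "?c \<in> closure (adjoint A ` dual_cone K)"
    using mem_closure_adjoint_image_iff assms by blast
  show "\<not> closed (adjoint A ` dual_cone K)"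
  proof
    assume "closed (adjoint A ` dual_cone K)"
    then obtain y where y: "y \<in> dual_cone K" "adjoint A y = ?c" using closure by auto
    have eq: "as ! i \<bullet> y = as ! i \<bullet> ys ! l" if i: "i < k + 1" for i
    proof -
      obtain x where "as ! i = A x" using range[OF i] by blast
      then show ?thesis using adjoint_works[OF A, of x] y(2) by metis
    qed
    have "as ! i \<bullet> y = 0" if "i < k" for i using eq[of i] vals[of i] that by simp
    then have "0 \<le> as ! k \<bullet> y" by (rule FR_inner_nonneg[OF as y(1)])
    then show False using eq[of k] vals[of k] by simp
  qed
qed

end
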